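(* Let $P \in \mathbb{Z}[x]$ be a monic polynomial of degree $d$ with roots $\alpha_1,\dots,\alpha_d$, and let $n>1$ be an integer with $l$ distinct prime factors. Put $r = 2^{l-1}$. Then the integer $U(n) = U(P;n)$ is divisible by $n^{d^r}$.
   Context: Roots are listed with multiplicity. For a multiset $\mathcal{N}=\{n_1,\dots,n_r\}$ of positive integers (entries may repeat), define $P_{\mathcal{N}}(x) := \prod_{j_1,\dots,j_r=1}^{d}\big(x-\alpha_{j_1}^{n_1}\cdots\alpha_{j_r}^{n_r}\big)\in\mathbb{Z}[x]$, a monic polynomial of degree $d^r$. For $n>1$ let $\mathcal{D}_+(n)=\{m\mid n:\mu(n/m)=1\}$ and $\mathcal{D}_-(n)=\{m\mid n:\mu(n/m)=-1\}$, where $\mu$ is the Möbius function; if $n$ has $l$ distinct prime factors, each of these sets has $2^{l-1}$ elements. For monic polynomials $A,B$ the resultant is $\operatorname{Res}(A,B)=\prod_{A(a)=0,\,B(b)=0}(a-b)$ (roots with multiplicity). Define $U(n)=U(P;n):=\operatorname{Res}(P_{\mathcal{D}_+(n)},P_{\mathcal{D}_-(n)})\in\mathbb{Z}$. *)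

theory Defs
  imports
    "HOL-Computational_Algebra.Computational_Algebra"
    "HOL-Combinatorics.Permutations"
    "HOL-Library.FuncSet"
begin

definition moebius :: "nat \<Rightarrow> int" where
  "moebius n = (if squarefree n then (- 1) ^ card (prime_factors n) else 0)"

definition D_plus :: "nat \<Rightarrow> nat set" where
  "D_plus n = {m. m dvd n \<and> moebius (n div m) = 1}"

definition D_minus :: "nat \<Rightarrow> nat set" where
  "D_minus n = {m. m dvd n \<and> moebius (n div m) = - 1}"

(* For a list ns = [n_1, ..., n_r] of exponents; positions are 0-based, while the
   roots are alpha 1, ..., alpha d, listed with multiplicity. *)
definition root_product_poly_list :: "(nat \<Rightarrow> complex) \<Rightarrow> nat \<Rightarrow> nat list \<Rightarrow> complex poly" where
  "root_product_poly_list \<alpha> d ns =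
     (\<Prod>j\<in>{..<length ns} \<rightarrow>\<^sub>E {1..d}. [:- (\<Prod>i<length ns. \<alpha> (j i) ^ (ns ! i)), 1:])"

(* The polynomial P_N of a multiset N. N is listed in increasing order, but by
   root_product_poly_mset below every listing gives the same polynomial. *)
definition root_product_poly :: "(nat \<Rightarrow> complex) \<Rightarrow> nat \<Rightarrow> nat multiset \<Rightarrow> complex poly" where
  "root_product_poly \<alpha> d N = root_product_poly_list \<alpha> d (sorted_list_of_multiset N)"

(* The resultant of monic polynomials as the product of root differences, where proots
   lists the roots with multiplicity. *)
definition Res :: "complex poly \<Rightarrow> complex poly \<Rightarrow> complex" where
  "Res A B = (\<Prod>a\<in>#proots A. \<Prod>b\<in>#proots B. a - b)"

(* U(P; n) in terms of the roots alpha 1, ..., alpha d of P. *)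
definition U :: "(nat \<Rightarrow> complex) \<Rightarrow> nat \<Rightarrow> nat \<Rightarrow> complex" where
  "U \<alpha> d n = Res (root_product_poly \<alpha> d (mset_set (D_plus n)))
                  (root_product_poly \<alpha> d (mset_set (D_minus n)))"

lemma root_product_poly_list_cong_mset:
  assumes "mset ns = mset ms"
  shows "root_product_poly_list \<alpha> d ns = root_product_poly_list \<alpha> d ms"
proof -
  define r where "r = length ms"
  obtain p where p: "p permutes {..<r}" and ns: "permute_list p ms = ns"
    using mset_eq_permutation[OF assms] unfolding r_def by blast
  have len: "length ns = r"
    using ns by (auto simp: r_def)
  have nth: "ns ! i = ms ! p i" if "i < r" for i
    using permute_list_nth[of p ms i] p ns that by (simp add: r_def)
  have pin: "p i < r \<longleftrightarrow> i < r" for i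
    using permutes_in_image[OF p, of i] by simp
  have qin: "inv p i < r \<longleftrightarrow> i < r" for i
    using permutes_in_image[OF permutes_inv[OF p], of i] by simp
  have pq: "p (inv p i) = i" "inv p (p i) = i" for i
    using permutes_inverses[OF p] by auto
  have bij: "bij_betw (\<lambda>j. \<lambda>i\<in>{..<r}. j (p i)) ({..<r} \<rightarrow>\<^sub>E {1..d}) ({..<r} \<rightarrow>\<^sub>E {1..d})"
    by (rule bij_betwI[where g = "\<lambda>j. \<lambda>i\<in>{..<r}. j (inv p i)"])
       (auto simp: pin qin pq PiE_def Pi_def extensional_def fun_eq_iff restrict_def)
  have "root_product_poly_list \<alpha> d ns =
      (\<Prod>j\<in>{..<r} \<rightarrow>\<^sub>E {1..d}. [:- (\<Prod>i<r. \<alpha> (j i) ^ (ns ! i)), 1:])"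
    by (simp add: root_product_poly_list_def len)
  also have "\<dots> = (\<Prod>j\<in>{..<r} \<rightarrow>\<^sub>E {1..d}.
      [:- (\<Prod>i<r. \<alpha> ((\<lambda>i\<in>{..<r}. j (p i)) i) ^ (ns ! i)), 1:])"
    by (rule prod.reindex_bij_betw[OF bij, symmetric])
  also have "\<dots> = (\<Prod>j\<in>{..<r} \<rightarrow>\<^sub>E {1..d}. [:- (\<Prod>i<r. \<alpha> (j (p i)) ^ (ms ! p i)), 1:])"
    by (simp add: nth)
  also have "\<dots> = (\<Prod>j\<in>{..<r} \<rightarrow>\<^sub>E {1..d}. [:- (\<Prod>i<r. \<alpha> (j i) ^ (ms ! i)), 1:])"
  proof -
    have "(\<Prod>i<r. \<alpha> (j (p i)) ^ (ms ! p i)) = (\<Prod>i<r. \<alpha> (j i) ^ (ms ! i))" for j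
      by (rule prod.reindex_bij_betw[OF permutes_imp_bij[OF p], of "\<lambda>i. \<alpha> (j i) ^ (ms ! i)"])
    then show ?thesis by simp
  qed
  also have "\<dots> = root_product_poly_list \<alpha> d ms"
    by (simp add: root_product_poly_list_def r_def)
  finally show ?thesis .
qed

lemma root_product_poly_mset:
  "root_product_poly \<alpha> d (mset ns) = root_product_poly_list \<alpha> d ns"
  unfolding root_product_poly_def by (rule root_product_poly_list_cong_mset) simp

end

(* Write s_k for the k-th power sum of the roots of P. Expanding prod_i (1 - alpha_i X) as an
   infinite product prod_k (1 - c_k X^k) gives s_n = sum_{k | n} k c_k^(n/k). Hence the c_k, or
   equivalently the coefficients of the polynomial, are integers iff the s_n are integers with
   the Gauss congruences s_{p^(b+1) m} = s_{p^b m} (mod p^(b+1)). Likewise two such polynomials of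
   the same degree are congruent mod p^e once their power sums at p^b m are congruent
   mod p^(e+b).

   The k-th power sum of the polynomial of a set D of exponents is prod_{m in D} s_{mk}. For a
   prime p dividing n, multiplying or dividing by p matches D_+(n) with D_-(n), and the Gauss
   congruences for matched factors yield the two polynomials A, B congruent mod n. So
   B = A + n C with C integral, and the resultant, which is the product of B(a) over the roots a
   of A, equals n^(deg A) prod_a C(a). Finally prod_a C(a) is an integer because the power sums of
   the numbers C(a) again satisfy the Gauss congruences. *)
theory Submission
  imports Defs "HOL-Number_Theory.Cong"
begin

section \<open>Gauss congruences and Witt coordinates\<close>

text \<open>Each \<open>p\<close>-th power gains one factor \<open>p\<close>: the cofactor of
  \<open>X - Y\<close> in \<open>X ^ p - Y ^ p\<close> is congruent to
  \<open>of_nat p * Y ^ (p - 1)\<close>, hence to 0, modulo \<open>p\<close>. The ring is general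
  because integer polynomials are needed later besides integers.\<close>

lemma power_power_diff_dvd:
  fixes x y :: "'a :: comm_ring_1"
  assumes "of_nat p ^ e dvd x - y" and "e \<ge> 1"
  shows "of_nat p ^ (e + w) dvd x ^ (p ^ w) - y ^ (p ^ w)"
proof (induction w)
  case 0
  then show ?case using assms by simp
next
  case (Suc w)
  define X Y where "X = x ^ (p ^ w)" and "Y = y ^ (p ^ w)"
  have XY: "of_nat p ^ (e + w) dvd X - Y"
    using Suc by (simp add: X_def Y_def)
  have "(of_nat p :: 'a) dvd of_nat p ^ (e + w)"
    using assms(2) by (intro dvd_power) auto
  then have pXY: "of_nat p dvd X - Y"
    using XY dvd_trans by blast
  have "of_nat p dvd (\<Sum>i<p. Y ^ (p - Suc i) * X ^ i - Y ^ (p - Suc i) * Y ^ i)"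
  proof (rule dvd_sum)
    fix i
    have "X - Y dvd X ^ i - Y ^ i"
      by (cases "i = 0") (auto simp: power_diff_sumr2)
    then show "of_nat p dvd Y ^ (p - Suc i) * X ^ i - Y ^ (p - Suc i) * Y ^ i"
      using pXY by (metis dvd_mult dvd_trans right_diff_distrib)
  qed
  moreover have "(\<Sum>i<p. Y ^ (p - Suc i) * Y ^ i) = of_nat p * Y ^ (p - 1)"
    by (simp flip: power_add)
  ultimately have "of_nat p dvd (\<Sum>i<p. Y ^ (p - Suc i) * X ^ i)"
    by (simp add: sum_subtractf dvd_diff_right_iff dvd_diff_left_iff)
  then have "of_nat p ^ (e + w) * of_nat p dvd (X - Y) * (\<Sum>i<p. Y ^ (p - Suc i) * X ^ i)"
    using XY by (rule mult_dvd_mono[rotated])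
  also have "\<dots> = X ^ p - Y ^ p"
    by (rule power_diff_sumr2[symmetric])
  finally show ?case
    by (simp add: X_def Y_def mult.commute flip: power_mult)
qed

text \<open>With \<open>p ^ w\<close> the exact power of \<open>p\<close> in \<open>j\<close>,
  raising to the power \<open>j\<close> gains \<open>p ^ w\<close>, and the weight \<open>k\<close>
  supplies what is still missing from \<open>p ^ b\<close>.\<close>

lemma weighted_power_diff_dvd:
  fixes x y :: int
  assumes p: "prime p" and xy: "int p ^ e dvd x - y" "e \<ge> 1"
    and kj: "p ^ b dvd k * j" and "j > 0"
  shows "int p ^ (e + b) dvd int k * (x ^ j - y ^ j)"
proof -
  define w where "w = multiplicity p j"
  obtain i where i: "j = p ^ w * i" "\<not> p dvd i"
    using multiplicity_decompose'[of j p] p \<open>j > 0\<close>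
    by (metis w_def not_prime_unit not_gr_zero)
  have "coprime (p ^ b) i"
    using p i(2) by (simp add: prime_imp_coprime)
  then have "p ^ b dvd k * p ^ w"
    using kj i(1) by (metis coprime_dvd_mult_left_iff mult.assoc)
  then have "int p ^ b dvd int k * int p ^ w"
    by (metis of_nat_dvd_iff of_nat_mult of_nat_power)
  then have "int p ^ e * int p ^ b dvd int k * int p ^ (e + w)"
    by (simp add: power_add mult_dvd_mono mult.left_commute)
  moreover have "int p ^ (e + w) dvd (x ^ i) ^ (p ^ w) - (y ^ i) ^ (p ^ w)"
  proof (rule power_power_diff_dvd[OF _ xy(2)])
    have "x - y dvd x ^ i - y ^ i"
      by (cases "i = 0") (auto simp: power_diff_sumr2)
    then show "int p ^ e dvd x ^ i - y ^ i"
      using xy(1) dvd_trans by blast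
  qed
  then have "int k * int p ^ (e + w) dvd int k * (x ^ j - y ^ j)"
    by (auto simp: i(1) mult.commute simp flip: power_mult intro: mult_dvd_mono)
  ultimately show ?thesis
    by (metis dvd_trans power_add)
qed

lemma prime_dvd_binomial_power_diff:
  fixes x y :: "'a :: comm_ring_1"
  assumes p: "prime p"
  shows "of_nat p dvd (x + y) ^ p - (x ^ p + y ^ p)"
proof -
  have "p > 0"
    using p by (rule prime_gt_0_nat)
  have "(x + y) ^ p = (\<Sum>k\<in>{0, p}. of_nat (p choose k) * x ^ k * y ^ (p - k))
      + (\<Sum>k\<in>{0<..<p}. of_nat (p choose k) * x ^ k * y ^ (p - k))"
    unfolding binomial_ring by (subst sum.union_disjoint[symmetric]) (auto intro!: sum.cong)
  then have "(x + y) ^ p - (x ^ p + y ^ p) =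
      (\<Sum>k\<in>{0<..<p}. of_nat (p choose k) * x ^ k * y ^ (p - k))"
    using \<open>p > 0\<close> by simp
  moreover have "(of_nat p :: 'a) dvd of_nat (p choose k)" if "k \<in> {0<..<p}" for k
  proof -
    have "p dvd p choose k"
      using that p by (intro dvd_choose_prime) auto
    then show ?thesis
      by (auto elim!: dvdE)
  qed
  ultimately show ?thesis
    by (auto intro!: dvd_sum dvd_mult2)
qed

text \<open>Fermat's little theorem for all integers, by induction from 0 in both directions using
  the binomial congruence.\<close>

lemma prime_dvd_power_diff:
  fixes x :: int
  assumes p: "prime p"
  shows "int p dvd x ^ p - x"
proof (induction x rule: int_induct[where k = 0])
  case base
  then show ?case using prime_gt_0_nat[OF p] by (simp add: zero_power)
next
  case (step1 x)
  have "(x + 1) ^ p - (x + 1) = ((x + 1) ^ p - (x ^ p + 1 ^ p)) + (x ^ p - x)"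
    by simp
  moreover have "int p dvd \<dots>"
    using prime_dvd_binomial_power_diff[OF p, of x 1] step1 by (intro dvd_add) auto
  ultimately show ?case by (simp only:)
next
  case (step2 x)
  have "(x - 1) ^ p - (x - 1) = (x ^ p - x) - ((x - 1 + 1) ^ p - ((x - 1) ^ p + 1 ^ p))"
    by simp
  moreover have "int p dvd \<dots>"
    using prime_dvd_binomial_power_diff[OF p, of "x - 1" 1] step2(2) by (rule dvd_diff[rotated])
  ultimately show ?case by (simp only:)
qed

section \<open>Gauss congruences of Witt sums and recovery of the coordinates\<close>

text \<open>Here \<open>m\<close> may be a multiple of \<open>p\<close>, and \<open>s 0\<close> is
  left unconstrained.\<close>

definition gauss_congruences :: "(nat \<Rightarrow> int) \<Rightarrow> bool" where
  "gauss_congruences s \<longleftrightarrow>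
     (\<forall>p b m. prime p \<longrightarrow> m > 0 \<longrightarrow> int p ^ Suc b dvd s (p ^ Suc b * m) - s (p ^ b * m))"

lemma gauss_congruencesD:
  "gauss_congruences s \<Longrightarrow> prime p \<Longrightarrow> m > 0 \<Longrightarrow>
     int p ^ Suc b dvd s (p ^ Suc b * m) - s (p ^ b * m)"
  by (auto simp: gauss_congruences_def)

text \<open>These are the ghost components of the big Witt vector with coordinates
  \<open>c\<close>.\<close>

definition witt_sum :: "(nat \<Rightarrow> 'a :: comm_ring_1) \<Rightarrow> nat \<Rightarrow> 'a" where
  "witt_sum c n = (\<Sum>k | k dvd n. of_nat k * c k ^ (n div k))"

lemma witt_sum_of_int: "witt_sum (\<lambda>k. of_int (c k)) n = of_int (witt_sum c n)"
  by (simp add: witt_sum_def)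

lemma witt_sum_cong:
  assumes "n > 0" "\<And>k. 0 < k \<Longrightarrow> k \<le> n \<Longrightarrow> c k = c' k"
  shows "witt_sum c n = witt_sum c' n"
  unfolding witt_sum_def using assms
  by (intro sum.cong refl) (metis dvd_imp_le dvd_pos_nat mem_Collect_eq)

lemma witt_sum_update:
  assumes "n > 0"
  shows "witt_sum c n = of_nat n * (c n - x) + witt_sum (c(n := x)) n"
proof -
  have fin: "finite {k. k dvd n}"
    using assms by simp
  show ?thesis
    unfolding witt_sum_def using assms
    by (simp add: sum.remove[OF fin, of n] algebra_simps)
qed

text \<open>Compare the sums at \<open>N = p * M\<close> and at \<open>M\<close>. A divisor
  \<open>k\<close> of \<open>N\<close> that does not divide \<open>M\<close> itself carries the
  factor \<open>p ^ Suc b\<close>. For \<open>k\<close> dividing \<open>M\<close> the terms pair up,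
  and Fermat's theorem makes each pair congruent.\<close>

lemma gauss_congruences_witt_sum: "gauss_congruences (witt_sum c)"
  unfolding gauss_congruences_def
proof (intro allI impI)
  fix p b m :: nat
  assume p: "prime p" and m: "m > 0"
  define N M where "N = p ^ Suc b * m" and "M = p ^ b * m"
  have pos: "p > 0" "N > 0" "M > 0"
    using p m by (auto simp: N_def M_def prime_gt_0_nat)
  have NM: "N = p * M"
    by (simp add: N_def M_def)
  have sub: "{k. k dvd M} \<subseteq> {k. k dvd N}"
    by (auto simp: NM)
  have "witt_sum c N = (\<Sum>k \<in> {k. k dvd N} - {k. k dvd M}. int k * c k ^ (N div k))
      + (\<Sum>k | k dvd M. int k * c k ^ (N div k))"
    unfolding witt_sum_def using sub pos by (intro sum.subset_diff) auto
  then have eq: "witt_sum c N - witt_sum c M =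
      (\<Sum>k \<in> {k. k dvd N} - {k. k dvd M}. int k * c k ^ (N div k))
      + (\<Sum>k | k dvd M. int k * (c k ^ (N div k) - c k ^ (M div k)))"
    by (simp add: witt_sum_def sum_subtractf right_diff_distrib)
  have "int p ^ Suc b dvd int k * c k ^ (N div k)" if k: "k dvd N" "\<not> k dvd M" for k
  proof -
    obtain j where j: "N = k * j"
      using k(1) by blast
    have "\<not> p dvd j"
    proof
      assume "p dvd j"
      then obtain i where "j = p * i" by blast
      then have "p * M = p * (k * i)"
        using NM j by (metis mult.left_commute)
      then have "M = k * i"
        using pos(1) by simp
      then show False
        using k(2) by simp
    qed
    then have "coprime (p ^ Suc b) j"
      using p by (simp add: prime_imp_coprime)
    moreover have "p ^ Suc b dvd k * j"
      unfolding j[symmetric] N_def by simp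
    ultimately have "p ^ Suc b dvd k"
      by (simp add: coprime_dvd_mult_left_iff)
    then show ?thesis
      by (metis dvd_mult2 of_nat_dvd_iff of_nat_power)
  qed
  moreover have "int p ^ Suc b dvd int k * (c k ^ (N div k) - c k ^ (M div k))" if k: "k dvd M" for k
  proof -
    obtain j where j: "M = k * j"
      using k by blast
    have kj: "k > 0" "j > 0"
      using pos j by auto
    \<comment> \<open>This is \<open>weighted_power_diff_dvd\<close> with \<open>e = 1\<close> and
      the bases \<open>c k ^ p\<close> and \<open>c k\<close>.\<close>
    have "int p ^ (1 + b) dvd int k * ((c k ^ p) ^ j - c k ^ j)"
      using kj(2) j by (intro weighted_power_diff_dvd p)
        (auto simp: prime_dvd_power_diff[OF p] M_def simp flip: j)
    moreover have "N div k = p * j" "M div k = j"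
      using kj by (auto simp: NM j)
    ultimately show ?thesis
      by (simp add: power_mult)
  qed
  ultimately show "int p ^ Suc b dvd witt_sum c (p ^ Suc b * m) - witt_sum c (p ^ b * m)"
    unfolding N_def[symmetric] M_def[symmetric] eq
    by (intro dvd_add dvd_sum) auto
qed

lemma dvd_int_if_prime_powers_dvd:
  fixes x :: int
  assumes "n > 0" "\<And>p. prime p \<Longrightarrow> p dvd n \<Longrightarrow> int (p ^ multiplicity p n) dvd x"
  shows "int n dvd x"
proof -
  have "n dvd nat \<bar>x\<bar>"
  proof (cases "x = 0")
    case False
    show ?thesis
    proof (rule multiplicity_le_imp_dvd)
      fix p :: nat
      assume p: "prime p"
      show "multiplicity p n \<le> multiplicity p (nat \<bar>x\<bar>)"
      proof (cases "p dvd n")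
        case True
        then have "p ^ multiplicity p n dvd nat \<bar>x\<bar>"
          using assms(2)[OF p True] by (simp only: int_dvd_int_iff [symmetric]) simp
        then show ?thesis
          using False p by (intro multiplicity_geI) auto
      qed (simp add: not_dvd_imp_multiplicity_0)
    qed (use assms in auto)
  qed simp
  then show ?thesis
    by (metis dvd_abs_iff int_dvd_int_iff int_nat_eq abs_ge_zero)
qed

text \<open>Converse of \<open>gauss_congruences_witt_sum\<close>, a form of Dwork's lemma.\<close>

lemma witt_coordinates_Ints:
  fixes c :: "nat \<Rightarrow> complex"
  assumes s: "gauss_congruences s" and "\<And>n. n > 0 \<Longrightarrow> of_int (s n) = witt_sum c n"
  shows "n > 0 \<Longrightarrow> c n \<in> \<int>"
proof (induction n rule: less_induct)
  case (less n)
  have "\<forall>k. \<exists>z. 0 < k \<and> k < n \<longrightarrow> c k = of_int z"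
    using less.IH by (metis Ints_cases)
  then obtain z where z: "\<And>k. 0 < k \<Longrightarrow> k < n \<Longrightarrow> c k = of_int (z k)"
    by metis
  \<comment> \<open>\<open>t\<close> satisfies the Gauss congruences and agrees with \<open>s\<close> below \<open>n\<close>, so \<open>n\<close> divides
    \<open>s n - t n = n c\<^sub>n\<close>.\<close>
  define t where "t = witt_sum (z(n := 0))"
  have below: "s k = t k" if "0 < k" "k < n" for k
  proof -
    have "(of_int (s k) :: complex) = witt_sum c k"
      using assms(2) that by blast
    also have "\<dots> = witt_sum (\<lambda>i. of_int ((z(n := 0)) i)) k"
      using that z by (intro witt_sum_cong) auto
    finally show ?thesis
      by (simp only: witt_sum_of_int t_def of_int_eq_iff)
  qed
  have "of_int (s n) = witt_sum c n"
    using assms(2) less.prems by blast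
  also have "\<dots> = of_nat n * c n + witt_sum (c(n := 0)) n"
    using witt_sum_update[OF less.prems, of c 0] by simp
  also have "witt_sum (c(n := 0)) n = witt_sum (\<lambda>i. of_int ((z(n := 0)) i)) n"
    using z less.prems by (intro witt_sum_cong) auto
  finally have nc: "of_nat n * c n = of_int (s n - t n)"
    by (simp add: witt_sum_of_int t_def fun_upd_def del: fun_upd_apply)
  have "int n dvd s n - t n"
  proof (rule dvd_int_if_prime_powers_dvd[OF less.prems])
    fix p assume p: "prime p" "p dvd n"
    \<comment> \<open>One less than the multiplicity, so that \<open>p ^ b * m\<close> is n / p.
      This is smaller than \<open>n\<close>, hence \<open>s\<close> and \<open>t\<close> agree
      there.\<close>
    define b where "b = multiplicity p n - 1"
    have b: "multiplicity p n = Suc b"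
      using p less.prems by (simp add: b_def prime_multiplicity_gt_zero_iff)
    obtain m where m: "n = p ^ Suc b * m"
      using multiplicity_dvd[of p n] unfolding b by blast
    have pos: "m > 0" "p > 1"
      using less.prems m prime_gt_1_nat[OF p(1)] by (auto intro!: Nat.gr0I)
    have "s (p ^ b * m) = t (p ^ b * m)"
      using pos by (intro below) (auto simp: m)
    then have "s n - t n = (s (p ^ Suc b * m) - s (p ^ b * m)) - (t (p ^ Suc b * m) - t (p ^ b * m))"
      by (simp add: m)
    moreover have "int p ^ Suc b dvd \<dots>"
      by (intro dvd_diff gauss_congruencesD s p pos)
        (simp add: t_def gauss_congruences_witt_sum)
    ultimately show "int (p ^ multiplicity p n) dvd s n - t n"
      by (simp add: b)
  qed
  then obtain q where "s n - t n = int n * q" by blast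
  then have "of_nat n * c n = of_nat n * of_int q"
    using nc by simp
  then show ?case
    using less.prems by simp
qed

text \<open>Let \<open>p ^ b\<close> be the exact power of \<open>p\<close> in \<open>n\<close>. By
  induction the terms with \<open>k < n\<close> agree modulo \<open>p ^ (e + b)\<close>. What
  remains is \<open>n * (c n - c' n)\<close>, and cancelling \<open>p ^ b\<close> leaves the modulus
  \<open>p ^ e\<close>.\<close>

lemma witt_coordinates_cong:
  fixes c c' :: "nat \<Rightarrow> int"
  assumes p: "prime p" and e: "e \<ge> 1"
    and s: "\<And>b m. m > 0 \<Longrightarrow>
      int p ^ (e + b) dvd witt_sum c (p ^ b * m) - witt_sum c' (p ^ b * m)"
  shows "n > 0 \<Longrightarrow> int p ^ e dvd c n - c' n"
proof (induction n rule: less_induct)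
  case (less n)
  define b where "b = multiplicity p n"
  obtain m where m: "n = p ^ b * m" "\<not> p dvd m"
    using multiplicity_decompose'[of n p] p less.prems
    by (metis b_def not_prime_unit not_gr_zero)
  have "m > 0"
    using less.prems m by (auto intro!: Nat.gr0I)
  have fin: "finite {k. k dvd n}"
    using less.prems by simp
  have eq: "witt_sum c n - witt_sum c' n =
      int n * (c n - c' n) + (\<Sum>k \<in> {k. k dvd n} - {n}. int k * (c k ^ (n div k) - c' k ^ (n div k)))"
    unfolding witt_sum_def using less.prems
    by (simp add: sum.remove[OF fin, of n] sum_subtractf algebra_simps)
  have "int p ^ (e + b) dvd (\<Sum>k \<in> {k. k dvd n} - {n}. int k * (c k ^ (n div k) - c' k ^ (n div k)))"
  proof (rule dvd_sum)
    fix k assume k: "k \<in> {k. k dvd n} - {n}"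
    then have "0 < k" "k < n"
      using less.prems by (auto simp: dvd_pos_nat dest: dvd_imp_le)
    then show "int p ^ (e + b) dvd int k * (c k ^ (n div k) - c' k ^ (n div k))"
      using k less by (intro weighted_power_diff_dvd p e) (auto simp: m div_greater_zero_iff dest: dvd_imp_le)
  qed
  moreover have "int p ^ (e + b) dvd witt_sum c n - witt_sum c' n"
    unfolding m(1) by (rule s) fact
  ultimately have "int p ^ (e + b) dvd int n * (c n - c' n)"
    unfolding eq by (simp add: dvd_add_left_iff)
  then have "int p ^ b * int p ^ e dvd int p ^ b * (int m * (c n - c' n))"
    by (simp add: m power_add mult.assoc mult.commute[of "_ ^ e"])
  then have "int p ^ e dvd int m * (c n - c' n)"
    using p by (subst (asm) dvd_mult_cancel_left) (auto simp: prime_gt_0_nat)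
  moreover have "coprime (int p ^ e) (int m)"
    using p m(2) by (metis coprime_int_iff coprime_power_left_iff prime_imp_coprime of_nat_power)
  ultimately show ?case
    by (simp add: coprime_dvd_mult_right_iff)
qed

section \<open>Power sums and coefficients\<close>

definition linear_factor_fps :: "'a :: comm_ring_1 \<Rightarrow> nat \<Rightarrow> 'a fps" where
  "linear_factor_fps a k = 1 - fps_const a * fps_X ^ k"

text \<open>Truncation of the infinite product; the factors beyond \<open>m\<close> do not affect the
  coefficients up to \<open>m\<close>.\<close>
definition witt_prod :: "(nat \<Rightarrow> 'a :: comm_ring_1) \<Rightarrow> nat \<Rightarrow> 'a fps" where
  "witt_prod c m = (\<Prod>k\<in>{1..m}. linear_factor_fps (c k) k)"

lemma witt_prod_Suc: "witt_prod c (Suc m) = witt_prod c m * linear_factor_fps (c (Suc m)) (Suc m)"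
  by (simp add: witt_prod_def)

lemma nth_linear_factor_mult:
  "fps_nth (F * linear_factor_fps a k) i =
     fps_nth F i - (if i < k then 0 else fps_nth F (i - k) * a)"
proof -
  have "F * linear_factor_fps a k = F - fps_const a * (fps_X ^ k * F)"
    by (simp add: linear_factor_fps_def algebra_simps)
  then show ?thesis
    by (simp add: fps_X_power_mult_nth)
qed

lemma nth_0_linear_factor [simp]: "k > 0 \<Longrightarrow> fps_nth (linear_factor_fps a k) 0 = 1"
  by (simp add: linear_factor_fps_def)

lemma nth_0_witt_prod [simp]: "fps_nth (witt_prod c m) 0 = 1"
  by (induction m) (simp_all add: witt_prod_Suc nth_linear_factor_mult, simp add: witt_prod_def)

text \<open>The partial product has constant term 1, so the next factor can be chosen to correct the
  next coefficient without changing the earlier ones.\<close>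

lemma witt_coordinates_exist:
  fixes G :: "'a :: comm_ring_1 fps"
  assumes "fps_nth G 0 = 1"
  obtains c where "\<And>m i. i \<le> m \<Longrightarrow> fps_nth (witt_prod c m) i = fps_nth G i"
proof -
  \<comment> \<open>The recursion runs on the partial products, since each coordinate depends on the
    product before it; \<open>c\<close> is read off afterwards.\<close>
  define W where "W = rec_nat (1 :: 'a fps)
    (\<lambda>m w. w * linear_factor_fps (fps_nth w (Suc m) - fps_nth G (Suc m)) (Suc m))"
  have W: "W 0 = 1"
    "W (Suc m) = W m * linear_factor_fps (fps_nth (W m) (Suc m) - fps_nth G (Suc m)) (Suc m)" for m
    by (simp_all add: W_def)
  define c where "c k = fps_nth (W (k - 1)) k - fps_nth G k" for k
  have "witt_prod c m = W m" for m
    by (induction m) (simp_all add: W witt_prod_Suc c_def, simp add: witt_prod_def)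
  moreover have W0: "fps_nth (W m) 0 = 1" for m
    by (induction m) (simp_all add: W nth_linear_factor_mult)
  have "\<forall>i\<le>m. fps_nth (W m) i = fps_nth G i" for m
  proof (induction m)
    case 0
    then show ?case using assms by (simp add: W)
  next
    case (Suc m)
    then show ?case
      by (auto simp: W nth_linear_factor_mult W0 le_Suc_eq)
  qed
  ultimately show ?thesis
    using that by metis
qed

text \<open>Since \<open>witt_coordinates_exist\<close> holds over any commutative ring, applying it
  to the series of integers yields integer coordinates.\<close>

lemma witt_coordinates_exist_of_int:
  fixes G :: "complex fps"
  assumes G0: "fps_nth G 0 = 1" and G: "\<And>i. fps_nth G i \<in> \<int>"
  obtains c :: "nat \<Rightarrow> int"
    where "\<And>m i. i \<le> m \<Longrightarrow> of_int (fps_nth (witt_prod c m) i) = fps_nth G i"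
proof -
  have "\<forall>i. \<exists>z. of_int z = fps_nth G i"
    using G by (metis Ints_cases)
  then obtain g where g: "\<And>i. of_int (g i) = fps_nth G i"
    by metis
  have "g 0 = 1"
    using g[of 0] G0 by simp
  then obtain c where "\<And>m i. i \<le> m \<Longrightarrow> fps_nth (witt_prod c m) i = fps_nth (Abs_fps g) i"
    using witt_coordinates_exist[of "Abs_fps g"] by auto
  then show ?thesis
    using that g by (metis fps_nth_Abs_fps)
qed

lemma nth_witt_prod_of_int:
  "fps_nth (witt_prod (\<lambda>k. of_int (c k)) m) i = of_int (fps_nth (witt_prod c m) i)"
proof (induction m arbitrary: i)
  case 0
  then show ?case by (simp add: witt_prod_def)
next
  case (Suc m)
  then show ?case by (simp add: witt_prod_Suc nth_linear_factor_mult)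
qed

lemma nth_witt_prod_cong:
  fixes c c' :: "nat \<Rightarrow> int"
  assumes "\<And>k. k > 0 \<Longrightarrow> N dvd c k - c' k"
  shows "N dvd fps_nth (witt_prod c m) i - fps_nth (witt_prod c' m) i"
proof (induction m arbitrary: i)
  case 0
  then show ?case by (simp add: witt_prod_def)
next
  case (Suc m)
  have *: "a - b * x - (a' - b' * x') = (a - a') - ((b - b') * x + b' * (x - x'))"
    for a b x a' b' x' :: int
    by (simp add: algebra_simps)
  show ?case
  proof (cases "i < Suc m")
    case False
    have "N dvd fps_nth (witt_prod c m) i - fps_nth (witt_prod c m) (i - Suc m) * c (Suc m)
      - (fps_nth (witt_prod c' m) i - fps_nth (witt_prod c' m) (i - Suc m) * c' (Suc m))"
      unfolding * using assms[of "Suc m"]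
      by (intro dvd_diff[OF Suc dvd_add[OF dvd_mult2[OF Suc] dvd_mult]]) simp
    then show ?thesis
      using False by (simp add: witt_prod_Suc nth_linear_factor_mult)
  qed (use Suc in \<open>simp add: witt_prod_Suc nth_linear_factor_mult\<close>)
qed

text \<open>\<open>S = - X F' / F\<close> without the division; for \<open>F = \<Prod>(1 - a\<^sub>i X)\<close> this is the generating
  function of the power sums of the \<open>a\<^sub>i\<close>.\<close>
definition log_derivative :: "'a :: comm_ring_1 fps \<Rightarrow> 'a fps \<Rightarrow> bool" where
  "log_derivative F S \<longleftrightarrow> fps_X * fps_deriv F = - (S * F)"

lemma log_derivative_mult:
  "log_derivative F S \<Longrightarrow> log_derivative G T \<Longrightarrow> log_derivative (F * G) (S + T)"
  by (simp add: log_derivative_def algebra_simps) (metis mult.left_commute mult_minus_right)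

lemma log_derivative_prod:
  "(\<And>i. i \<in> I \<Longrightarrow> log_derivative (F i) (S i)) \<Longrightarrow> log_derivative (\<Prod>i\<in>I. F i) (\<Sum>i\<in>I. S i)"
proof (induction I rule: infinite_finite_induct)
  case (insert i I)
  then show ?case
    by (simp add: log_derivative_mult)
qed (simp_all add: log_derivative_def)

text \<open>The right-hand series is the geometric expansion of k a X^k / (1 - a X^k).\<close>

lemma log_derivative_linear_factor:
  assumes "k > 0"
  shows "log_derivative (linear_factor_fps a k)
           (Abs_fps (\<lambda>n. if n > 0 \<and> k dvd n then of_nat k * a ^ (n div k) else 0))"
    (is "log_derivative _ ?S")
proof -
  have "fps_nth (?S * linear_factor_fps a k) n = (if n = k then of_nat k * a else 0)" for n
  proof -
    consider "n < k" | "n = k" | "n > k" by linarith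
    then show ?thesis
    proof cases
      case 3
      then obtain j where j: "n = j + k" "j > 0"
        by (metis add.commute less_imp_add_positive)
      then show ?thesis
        using assms by (subst nth_linear_factor_mult) (auto simp: mult_ac)
    qed (use assms in \<open>auto simp: nth_linear_factor_mult dest: dvd_imp_le\<close>)
  qed
  then have "?S * linear_factor_fps a k = fps_const (of_nat k * a) * fps_X ^ k"
    by (intro fps_ext) (simp add: fps_X_power_nth)
  moreover have "fps_X * fps_deriv (linear_factor_fps a k) = - (fps_const (of_nat k * a) * fps_X ^ k)"
    using assms by (intro fps_ext) (auto simp: linear_factor_fps_def fps_X_power_nth)
  ultimately show ?thesis
    by (simp add: log_derivative_def)
qed

text \<open>Comparing coefficients gives the recursion of Newton's identities, which determines
  coefficient \<open>n\<close> of \<open>S\<close> from the coefficients of \<open>F\<close> up to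
  \<open>n\<close>. This lets a truncated product stand in for the infinite one.\<close>

lemma log_derivative_nth_unique:
  assumes "log_derivative F S" "log_derivative G T" "fps_nth F 0 = 1"
    and FG: "\<And>i. i \<le> m \<Longrightarrow> fps_nth F i = fps_nth G i" and "n \<le> m"
  shows "fps_nth S n = fps_nth T n"
  using \<open>n \<le> m\<close>
proof (induction n rule: less_induct)
  case (less n)
  have G0: "fps_nth G 0 = 1"
    using FG[of 0] assms(3) by simp
  have rec: "fps_nth U n = - of_nat n * fps_nth H n - (\<Sum>i<n. fps_nth U i * fps_nth H (n - i))"
    if "log_derivative H U" "fps_nth H 0 = 1" for H U :: "'a fps"
  proof -
    have "fps_nth (fps_X * fps_deriv H) n = - (\<Sum>i\<le>n. fps_nth U i * fps_nth H (n - i))"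
      using that(1) by (simp add: log_derivative_def fps_mult_nth atMost_atLeast0)
    moreover have "fps_nth (fps_X * fps_deriv H) n = of_nat n * fps_nth H n"
      by (cases n) auto
    ultimately have "of_nat n * fps_nth H n = - ((\<Sum>i<n. fps_nth U i * fps_nth H (n - i)) + fps_nth U n)"
      using that(2) by (simp add: lessThan_Suc_atMost[symmetric])
    then show ?thesis
      by simp
  qed
  show ?case
    unfolding rec[OF assms(1,3)] rec[OF assms(2) G0]
    using less FG by auto
qed

text \<open>The two products have the same logarithmic derivative up to degree \<open>n\<close>. Its
  coefficient at \<open>n\<close> is the Witt sum for one product and the power sum for the
  other.\<close>

lemma power_sum_eq_witt_sum:
  fixes a :: "'i \<Rightarrow> 'a :: comm_ring_1"
  assumes "\<And>i. i \<le> n \<Longrightarrow> fps_nth (witt_prod c n) i = fps_nth (\<Prod>i\<in>I. linear_factor_fps (a i) 1) i"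
    and "n > 0"
  shows "(\<Sum>i\<in>I. a i ^ n) = witt_sum c n"
proof -
  let ?S = "\<lambda>a k. Abs_fps (\<lambda>n. if n > 0 \<and> k dvd n then of_nat k * a ^ (n div k) else 0 :: 'a)"
  have "fps_nth (\<Sum>k\<in>{1..n}. ?S (c k) k) n = fps_nth (\<Sum>i\<in>I. ?S (a i) 1) n"
  proof (rule log_derivative_nth_unique[where m = n])
    show "log_derivative (witt_prod c n) (\<Sum>k\<in>{1..n}. ?S (c k) k)"
      unfolding witt_prod_def by (intro log_derivative_prod log_derivative_linear_factor) auto
    show "log_derivative (\<Prod>i\<in>I. linear_factor_fps (a i) 1) (\<Sum>i\<in>I. ?S (a i) 1)"
      by (intro log_derivative_prod log_derivative_linear_factor) auto
  qed (use assms in \<open>auto simp del: One_nat_def\<close>)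
  then have "(\<Sum>i\<in>I. a i ^ n) = (\<Sum>k\<in>{1..n}. if k dvd n then of_nat k * c k ^ (n div k) else 0)"
    using assms(2) by (simp add: fps_sum_nth)
  also have "\<dots> = (\<Sum>k | k \<in> {1..n} \<and> k dvd n. of_nat k * c k ^ (n div k))"
    by (rule sum.inter_filter[symmetric]) simp
  also have "{k. k \<in> {1..n} \<and> k dvd n} = {k. k dvd n}"
    using assms(2) by (auto simp: dvd_imp_le dvd_pos_nat Suc_le_eq)
  finally show ?thesis
    by (simp only: witt_sum_def)
qed

section \<open>Polynomials given by a family of roots\<close>

text \<open>An indexed family records multiplicities without multisets. An infinite \<open>I\<close>
  yields 1, in agreement with \<open>card I = 0\<close>.\<close>

definition root_poly :: "'i set \<Rightarrow> ('i \<Rightarrow> 'a :: idom) \<Rightarrow> 'a poly" where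
  "root_poly I a = (\<Prod>i\<in>I. [:- a i, 1:])"

lemma degree_root_poly [simp]: "degree (root_poly I a) = card I"
  by (cases "finite I") (simp_all add: root_poly_def degree_prod_eq_sum_degree)

lemma lead_coeff_root_poly: "lead_coeff (root_poly I a) = 1"
  unfolding root_poly_def by (simp only: lead_coeff_prod) simp

lemma proots_root_poly:
  assumes "finite I"
  shows "proots (root_poly I a) = image_mset a (mset_set I)"
  using assms by (simp add: root_poly_def proots_prod) (induction I rule: finite_induct; simp)

lemma poly_root_poly: "poly (root_poly I a) x = (\<Prod>i\<in>I. x - a i)"
  by (simp add: root_poly_def poly_prod)

text \<open>Reversing the coefficients is multiplicative and turns each factor X - a_i into 1 - a_i
  X.\<close>

lemma fps_of_reflect_root_poly:
  "fps_of_poly (reflect_poly (root_poly I a)) = (\<Prod>i\<in>I. linear_factor_fps (a i) 1)"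
proof -
  have "fps_of_poly (reflect_poly [:- a i, 1:]) = linear_factor_fps (a i) 1" for i
  proof -
    have "reflect_poly [:- a i, 1:] = [:1, - a i:]"
      by (cases "a i = 0") (simp_all add: reflect_poly_pCons reflect_poly_pCons')
    then show ?thesis
      by (simp add: linear_factor_fps_def fps_of_poly_pCons algebra_simps)
  qed
  then show ?thesis
    by (simp add: root_poly_def reflect_poly_prod fps_of_poly_prod)
qed

lemma nth_prod_linear_factor_fps:
  "fps_nth (\<Prod>i\<in>I. linear_factor_fps (a i) 1) k =
     (if k > card I then 0 else coeff (root_poly I a) (card I - k))"
  by (simp add: fps_of_reflect_root_poly[symmetric] coeff_reflect_poly del: One_nat_def)

lemma coeff_root_poly:
  "k \<le> card I \<Longrightarrow> coeff (root_poly I a) k =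
     fps_nth (\<Prod>i\<in>I. linear_factor_fps (a i) 1) (card I - k)"
  by (simp add: nth_prod_linear_factor_fps del: One_nat_def)

lemma nth_0_prod_linear_factor_fps:
  fixes a :: "'i \<Rightarrow> 'a :: idom"
  shows "fps_nth (\<Prod>i\<in>I. linear_factor_fps (a i) 1) 0 = 1"
  using lead_coeff_root_poly[of I a] by (simp add: nth_prod_linear_factor_fps del: One_nat_def)

text \<open>Integer coefficients give integer Witt coordinates, whose Witt sums are the power
  sums.\<close>

lemma gauss_congruences_power_sums:
  fixes Q :: "int poly" and a :: "'i \<Rightarrow> complex"
  assumes "map_poly of_int Q = root_poly I a"
  obtains s where "gauss_congruences s" "\<And>n. of_int (s n) = (\<Sum>i\<in>I. a i ^ n)"
proof -
  let ?G = "\<Prod>i\<in>I. linear_factor_fps (a i) 1"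
  have "coeff (root_poly I a) i \<in> \<int>" for i
    by (simp add: assms[symmetric] coeff_map_poly)
  then have "fps_nth ?G i \<in> \<int>" for i
    by (simp add: nth_prod_linear_factor_fps del: One_nat_def)
  then obtain c :: "nat \<Rightarrow> int"
    where c: "\<And>m i. i \<le> m \<Longrightarrow> of_int (fps_nth (witt_prod c m) i) = fps_nth ?G i"
    using witt_coordinates_exist_of_int nth_0_prod_linear_factor_fps by blast
  have sum: "(\<Sum>i\<in>I. a i ^ n) = of_int (witt_sum c n)" if "n > 0" for n
    unfolding witt_sum_of_int[symmetric]
    using that c by (intro power_sum_eq_witt_sum) (simp_all only: nth_witt_prod_of_int)
  show ?thesis
  proof (rule that)
    \<comment> \<open>The divisors of 0 form an infinite set, so \<open>witt_sum c 0\<close> is 0,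
      whereas the zeroth power sum is \<open>card I\<close>. The override is harmless because the
      Gauss congruences concern positive indices.\<close>
    show "gauss_congruences ((witt_sum c)(0 := int (card I)))"
      using gauss_congruences_witt_sum[of c]
      by (auto simp: gauss_congruences_def prime_gt_0_nat)
    show "of_int (((witt_sum c)(0 := int (card I))) n) = (\<Sum>i\<in>I. a i ^ n)" for n
      using sum by simp
  qed
qed

text \<open>The coordinates are first found over the complex numbers;
  \<open>witt_coordinates_Ints\<close> then shows that they are integers.\<close>

lemma integral_witt_coordinates:
  fixes a :: "'i \<Rightarrow> complex"
  assumes s: "gauss_congruences s" "\<And>n. n > 0 \<Longrightarrow> of_int (s n) = (\<Sum>i\<in>I. a i ^ n)"
  obtains c :: "nat \<Rightarrow> int" where
    "\<And>k. k \<le> card I \<Longrightarrow>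
       coeff (root_poly I a) k = of_int (fps_nth (witt_prod c (card I)) (card I - k))"
    "\<And>n. n > 0 \<Longrightarrow> s n = witt_sum c n"
proof -
  obtain c where c: "\<And>m i. i \<le> m \<Longrightarrow>
      fps_nth (witt_prod c m) i = fps_nth (\<Prod>i\<in>I. linear_factor_fps (a i) 1) i"
    using witt_coordinates_exist nth_0_prod_linear_factor_fps by blast
  have sc: "of_int (s n) = witt_sum c n" if "n > 0" for n
    using s(2)[OF that] power_sum_eq_witt_sum[OF c that] by simp
  then have "\<forall>n. \<exists>z. n > 0 \<longrightarrow> c n = of_int z"
    using witt_coordinates_Ints[OF s(1)] by (metis Ints_cases)
  then obtain z where z: "\<And>n. n > 0 \<Longrightarrow> c n = of_int (z n)"
    by metis
  show ?thesis
  proof (rule that)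
    fix n :: nat
    assume n: "n > 0"
    have "witt_sum c n = witt_sum (\<lambda>k. of_int (z k)) n"
      using n z by (intro witt_sum_cong) auto
    then show "s n = witt_sum z n"
      using sc[OF n] by (simp only: witt_sum_of_int of_int_eq_iff)
  next
    fix k assume k: "k \<le> card I"
    have "witt_prod c (card I) = witt_prod (\<lambda>k. of_int (z k)) (card I)"
      unfolding witt_prod_def by (intro prod.cong refl) (simp add: z)
    then show "coeff (root_poly I a) k = of_int (fps_nth (witt_prod z (card I)) (card I - k))"
      using c[of "card I - k" "card I"] k by (simp only: coeff_root_poly nth_witt_prod_of_int)
  qed
qed

text \<open>Converse of \<open>gauss_congruences_power_sums\<close>, the criterion by which products
  over complex roots are recognised as integer polynomials.\<close>

lemma integral_root_poly:
  fixes a :: "'i \<Rightarrow> complex"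
  assumes "gauss_congruences s" "\<And>n. n > 0 \<Longrightarrow> of_int (s n) = (\<Sum>i\<in>I. a i ^ n)"
  obtains Q :: "int poly" where "map_poly of_int Q = root_poly I a"
proof -
  obtain c :: "nat \<Rightarrow> int" where c: "\<And>k. k \<le> card I \<Longrightarrow>
      coeff (root_poly I a) k = of_int (fps_nth (witt_prod c (card I)) (card I - k))"
    using integral_witt_coordinates[OF assms] by blast
  define Q where "Q = (\<Sum>k\<le>card I. monom (fps_nth (witt_prod c (card I)) (card I - k)) k)"
  have "coeff (map_poly of_int Q) k = coeff (root_poly I a) k" for k
    by (cases "k \<le> card I")
      (simp_all add: coeff_map_poly Q_def coeff_sum c coeff_eq_0 if_distrib cong: if_cong)
  then show ?thesis
    using that by (auto simp: poly_eq_iff)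
qed

text \<open>The congruence passes from power sums to Witt coordinates and from there to
  coefficients. Equal degrees give both sides the same truncation and the same reversed
  index.\<close>

lemma root_poly_coeff_cong:
  fixes a :: "'i \<Rightarrow> complex" and b :: "'j \<Rightarrow> complex" and Q R :: "int poly"
  assumes Q: "map_poly of_int Q = root_poly I a" and R: "map_poly of_int R = root_poly J b"
    and card: "card I = card J"
    and s: "gauss_congruences s" "\<And>n. n > 0 \<Longrightarrow> of_int (s n) = (\<Sum>i\<in>I. a i ^ n)"
    and t: "gauss_congruences t" "\<And>n. n > 0 \<Longrightarrow> of_int (t n) = (\<Sum>j\<in>J. b j ^ n)"
    and p: "prime p" and e: "e \<ge> 1"
    and st: "\<And>k m. m > 0 \<Longrightarrow> int p ^ (e + k) dvd s (p ^ k * m) - t (p ^ k * m)"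
  shows "int p ^ e dvd coeff Q i - coeff R i"
proof -
  obtain c where c: "\<And>k. k \<le> card I \<Longrightarrow>
      coeff (root_poly I a) k = of_int (fps_nth (witt_prod c (card I)) (card I - k))"
    "\<And>n. n > 0 \<Longrightarrow> s n = witt_sum c n"
    using integral_witt_coordinates[OF s] by blast
  obtain c' where c': "\<And>k. k \<le> card J \<Longrightarrow>
      coeff (root_poly J b) k = of_int (fps_nth (witt_prod c' (card J)) (card J - k))"
    "\<And>n. n > 0 \<Longrightarrow> t n = witt_sum c' n"
    using integral_witt_coordinates[OF t] by blast
  have cc: "int p ^ e dvd c n - c' n" if "n > 0" for n
  proof (rule witt_coordinates_cong[OF p e _ that])
    fix k m :: nat
    assume "m > 0"
    then show "int p ^ (e + k) dvd witt_sum c (p ^ k * m) - witt_sum c' (p ^ k * m)"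
      using st[of m k] p by (simp add: c c' prime_gt_0_nat)
  qed
  have QR: "of_int (coeff Q i) = coeff (root_poly I a) i" "of_int (coeff R i) = coeff (root_poly J b) i"
    by (simp_all add: Q[symmetric] R[symmetric] coeff_map_poly)
  show ?thesis
  proof (cases "i \<le> card I")
    case True
    then have "coeff Q i = fps_nth (witt_prod c (card I)) (card I - i)"
      "coeff R i = fps_nth (witt_prod c' (card I)) (card I - i)"
      using QR c(1)[of i] c'(1)[of i] card by simp_all
    then show ?thesis
      by (simp add: nth_witt_prod_cong cc)
  qed (use QR card in \<open>simp add: coeff_eq_0\<close>)
qed

section \<open>Integrality of norms\<close>

text \<open>The binomial congruence splits off the constant coefficient, which Fermat's theorem
  handles; the rest is the induction hypothesis times x^p.\<close>

lemma poly_frobenius_dvd: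
  fixes F :: "int poly"
  assumes p: "prime p"
  shows "of_nat p dvd F ^ p - pcompose F (monom 1 p)"
proof (induction F rule: pCons_induct)
  case 0
  then show ?case using prime_gt_0_nat[OF p] by (simp add: zero_power)
next
  case (pCons a F)
  let ?X = "[:0, 1:] :: int poly"
  have eq: "pCons a F = [:a:] + ?X * F"
    by simp
  have X: "?X ^ p = monom 1 p"
    by (simp add: monom_altdef)
  have diff: "(pCons a F) ^ p - pcompose (pCons a F) (monom 1 p) =
      (([:a:] + ?X * F) ^ p - ([:a:] ^ p + (?X * F) ^ p)) + ([:a:] ^ p - [:a:])
        + monom 1 p * (F ^ p - pcompose F (monom 1 p))"
    unfolding eq[symmetric] power_mult_distrib X
    by (simp add: pcompose_pCons algebra_simps)
  have const: "of_nat p dvd [:a:] ^ p - [:a:]"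
  proof -
    have "int p dvd a ^ p - a"
      by (rule prime_dvd_power_diff[OF p])
    then obtain q where "a ^ p - a = int p * q" by blast
    then have "[:a:] ^ p - [:a:] = of_nat p * [:q:]"
      by (simp add: poly_const_pow of_nat_poly)
    then show ?thesis
      by (simp only: dvd_triv_left)
  qed
  show ?case
    unfolding diff
    by (intro dvd_add[OF dvd_add] prime_dvd_binomial_power_diff[OF p] const dvd_mult pCons.IH)
qed

text \<open>The derivative of \<open>F ^ n\<close> is a multiple of \<open>n\<close>, and its
  coefficients are the numbers \<open>j * coeff (F ^ n) j\<close>.\<close>

lemma dvd_coeff_power:
  fixes F :: "int poly"
  shows "int n dvd int j * coeff (F ^ n) j"
proof (cases j)
  case (Suc i)
  have "coeff (pderiv (F ^ n)) i = int n * coeff (F ^ (n - 1) * pderiv F) i"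
    by (simp add: pderiv_power mult.commute)
  then show ?thesis
    by (simp add: coeff_pderiv Suc)
qed simp

section \<open>Evaluation of integer polynomials and traces over roots\<close>

lemma poly_of_int_add:
  "poly (map_poly of_int (F + G)) x = poly (map_poly of_int F) x + poly (map_poly of_int G) (x :: 'a :: comm_ring_1)"
proof -
  have "map_poly of_int (F + G) = map_poly of_int F + (map_poly of_int G :: 'a poly)"
    by (intro poly_eqI) (simp add: coeff_map_poly)
  then show ?thesis by simp
qed

lemma poly_of_int_mult:
  "poly (map_poly of_int (F * G)) x = poly (map_poly of_int F) x * poly (map_poly of_int G) (x :: 'a :: comm_ring_1)"
proof -
  have "map_poly of_int (F * G) = map_poly of_int F * (map_poly of_int G :: 'a poly)"
    by (intro poly_eqI) (simp add: coeff_map_poly coeff_mult)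
  then show ?thesis by simp
qed

lemma poly_of_int_uminus:
  "poly (map_poly of_int (- F)) x = - poly (map_poly of_int F) (x :: 'a :: comm_ring_1)"
  using poly_of_int_add[of F "- F" x] by (simp add: eq_neg_iff_add_eq_0 add.commute)

lemma poly_of_int_power:
  "poly (map_poly of_int (F ^ n)) x = poly (map_poly of_int F) (x :: 'a :: comm_ring_1) ^ n"
  by (induction n) (simp_all add: poly_of_int_mult)

lemma poly_of_int_of_nat: "poly (map_poly of_int (of_nat k)) (x :: 'a :: comm_ring_1) = of_nat k"
  by (simp add: of_nat_poly map_poly_pCons)

lemma poly_of_int_smult:
  "poly (map_poly of_int (smult k F)) x = of_int k * poly (map_poly of_int F) (x :: 'a :: comm_ring_1)"
  using poly_of_int_mult[of "[:k:]" F x] by (simp add: map_poly_pCons)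

lemma poly_of_int_pcompose:
  "poly (map_poly of_int (pcompose F G)) x =
     poly (map_poly of_int F) (poly (map_poly of_int G) (x :: 'a :: comm_ring_1))"
  by (induction F) (simp_all add: pcompose_pCons poly_of_int_add poly_of_int_mult map_poly_pCons)

lemma pcompose_power: "pcompose (F ^ n) G = pcompose F G ^ n"
  by (induction n) (simp_all add: pcompose_mult pcompose_1)

text \<open>The linear functional on polynomials that sends \<open>x\<^sup>j\<close> to \<open>s j\<close>.\<close>
definition linear_extension :: "(nat \<Rightarrow> int) \<Rightarrow> int poly \<Rightarrow> int" where
  "linear_extension s F = (\<Sum>j\<le>degree F. coeff F j * s j)"

text \<open>When \<open>s\<close> lists power sums, the functional is a trace, so identities for it
  can be checked in the complex numbers.\<close>

lemma linear_extension_of_int: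
  fixes a :: "'i \<Rightarrow> complex"
  assumes "\<And>n. of_int (s n) = (\<Sum>i\<in>I. a i ^ n)"
  shows "of_int (linear_extension s F) = (\<Sum>i\<in>I. poly (map_poly of_int F) (a i))"
proof -
  have "poly (map_poly of_int F) x = (\<Sum>j\<le>degree F. of_int (coeff F j) * x ^ j)" for x :: complex
    by (simp add: poly_altdef degree_map_poly coeff_map_poly)
  then have "(\<Sum>i\<in>I. poly (map_poly of_int F) (a i)) =
      (\<Sum>j\<le>degree F. of_int (coeff F j) * (\<Sum>i\<in>I. a i ^ j))"
    by (simp add: sum_distrib_left sum.swap[of _ I])
  then show ?thesis
    by (simp add: linear_extension_def assms)
qed

text \<open>By \<open>linear_extension_of_int\<close> these integers are the power sums of the
  values of \<open>C\<close> at the roots \<open>a i\<close>.\<close>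

lemma gauss_congruences_linear_extension_power:
  fixes a :: "'i \<Rightarrow> complex" and C :: "int poly"
  assumes s: "gauss_congruences s" and sa: "\<And>n. of_int (s n) = (\<Sum>i\<in>I. a i ^ n)"
  shows "gauss_congruences (\<lambda>n. linear_extension s (C ^ n))"
  unfolding gauss_congruences_def
proof (intro allI impI)
  fix p b m :: nat
  assume p: "prime p" and m: "m > 0"
  let ?L = "linear_extension s"
  define E H where "E = C ^ m" and "H = E ^ (p ^ b)"
  \<comment> \<open>Pass from \<open>E ^ p ^ Suc b\<close> to \<open>H\<close> via \<open>K(x) = H(x\<^sup>p)\<close>: the first step is the Frobenius
    congruence, the second weighs \<open>p\<^sup>b | j H\<^sub>j\<close> against the Gauss congruences of \<open>s\<close>.\<close>
  define K where "K = pcompose H (monom 1 p)"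
  note L = linear_extension_of_int[OF sa]
  have L_diff: "?L F - ?L G = ?L (F - G)" for F G
  proof -
    have "complex_of_int (?L F) = of_int (?L (F - G) + ?L G)"
      using poly_of_int_add[of "F - G" G, where 'a = complex] by (simp add: L flip: sum.distrib)
    then show ?thesis by (simp only: of_int_eq_iff)
  qed
  have L_mult: "?L (of_nat k * F) = int k * ?L F" for k F
  proof -
    have "complex_of_int (?L (of_nat k * F)) = of_int (int k * ?L F)"
      by (simp add: L poly_of_int_mult poly_of_int_of_nat sum_distrib_left)
    then show ?thesis by (simp only: of_int_eq_iff)
  qed
  have "of_nat p ^ (1 + b) dvd (E ^ p) ^ (p ^ b) - pcompose E (monom 1 p) ^ (p ^ b)"
    by (rule power_power_diff_dvd) (simp_all add: poly_frobenius_dvd[OF p])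
  then have "of_nat (p ^ Suc b) dvd E ^ (p ^ Suc b) - K"
    by (simp add: K_def H_def pcompose_power flip: power_mult)
  then obtain D where "E ^ (p ^ Suc b) - K = of_nat (p ^ Suc b) * D" by blast
  then have first: "int (p ^ Suc b) dvd ?L (E ^ (p ^ Suc b)) - ?L K"
    by (simp only: L_diff L_mult) simp
  \<comment> \<open>The value of \<open>K\<close> at \<open>a i\<close> is that of \<open>H\<close>
    at \<open>a i ^ p\<close>, and the numbers \<open>a i ^ p\<close> have power sums
    \<open>s (p * j)\<close>.\<close>
  have "complex_of_int (?L K) = (\<Sum>i\<in>I. poly (map_poly of_int H) (a i ^ p))"
    by (simp add: L K_def poly_of_int_pcompose map_poly_monom poly_monom)
  also have "\<dots> = of_int (linear_extension (\<lambda>j. s (p * j)) H)"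
    by (rule linear_extension_of_int[symmetric]) (simp add: sa power_mult)
  finally have "?L K = linear_extension (\<lambda>j. s (p * j)) H"
    by (simp only: of_int_eq_iff)
  then have "?L K - ?L H = (\<Sum>j\<le>degree H. coeff H j * (s (p * j) - s j))"
    by (simp add: linear_extension_def sum_subtractf right_diff_distrib)
  moreover have "int (p ^ Suc b) dvd coeff H j * (s (p * j) - s j)" for j
  proof (cases "j = 0")
    case False
    \<comment> \<open>The difference \<open>s (p * j) - s j\<close> contributes
      \<open>p ^ Suc w\<close>. Since \<open>p ^ b\<close> divides \<open>j * coeff H j\<close> and
      \<open>j\<close> contains only \<open>p ^ w\<close>, it also divides
      \<open>p ^ w * coeff H j\<close>; together this gives \<open>p ^ Suc b\<close>.\<close>
    define w where "w = multiplicity p j"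
    obtain i where i: "j = p ^ w * i" "\<not> p dvd i"
      using multiplicity_decompose'[of j p] p False
      by (metis w_def not_prime_unit)
    have "i > 0" using False i by (auto intro!: Nat.gr0I)
    have "int p ^ Suc w dvd s (p ^ Suc w * i) - s (p ^ w * i)"
      by (rule gauss_congruencesD[OF s p \<open>i > 0\<close>])
    then obtain u where "s (p ^ Suc w * i) - s (p ^ w * i) = int p ^ Suc w * u"
      by (elim dvdE)
    then have u: "s (p * j) - s j = int p ^ Suc w * u"
      by (simp add: i(1) mult.assoc)
    have "int (p ^ b) dvd int (p ^ w * i) * coeff H j"
      using dvd_coeff_power[of "p ^ b" j E] by (simp only: H_def i(1))
    moreover have "coprime (int (p ^ b)) (int i)"
      using p i(2) by (metis coprime_int_iff coprime_power_left_iff prime_imp_coprime)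
    moreover have "int (p ^ w * i) * coeff H j = int i * (int (p ^ w) * coeff H j)"
      by (simp only: of_nat_mult mult_ac)
    ultimately have "int (p ^ b) dvd int (p ^ w) * coeff H j"
      by (simp only: coprime_dvd_mult_right_iff)
    then have "int p * int (p ^ b) dvd int p * (int (p ^ w) * coeff H j) * u"
      by (rule dvd_mult2[OF mult_dvd_mono[OF dvd_refl]])
    moreover have "coeff H j * (s (p * j) - s j) = int p * (int (p ^ w) * coeff H j) * u"
      unfolding u by (simp only: of_nat_power power_Suc mult_ac)
    ultimately show ?thesis
      by (simp only: of_nat_power of_nat_mult power_Suc)
  qed simp
  ultimately have second: "int (p ^ Suc b) dvd ?L K - ?L H"
    by (simp add: dvd_sum)
  have "?L (C ^ (p ^ Suc b * m)) - ?L (C ^ (p ^ b * m)) =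
      (?L (E ^ (p ^ Suc b)) - ?L K) + (?L K - ?L H)"
    by (simp add: E_def H_def mult.commute flip: power_mult)
  then show "int p ^ Suc b dvd ?L (C ^ (p ^ Suc b * m)) - ?L (C ^ (p ^ b * m))"
    using dvd_add[OF first second] by (simp only: of_nat_power)
qed

text \<open>The product is the constant coefficient of a polynomial whose power sums satisfy the
  Gauss congruences.\<close>

lemma prod_poly_roots_Ints:
  fixes Q C :: "int poly" and a :: "'i \<Rightarrow> complex"
  assumes "map_poly of_int Q = root_poly I a"
  shows "(\<Prod>i\<in>I. poly (map_poly of_int C) (a i)) \<in> \<int>"
proof -
  \<comment> \<open>Negated, so that the polynomial with these roots takes the required product as
    its value at 0, without a sign.\<close>
  let ?c = "\<lambda>i. - poly (map_poly of_int C) (a i)"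
  obtain s where s: "gauss_congruences s" "\<And>n. of_int (s n) = (\<Sum>i\<in>I. a i ^ n)"
    using gauss_congruences_power_sums[OF assms] by blast
  have "of_int (linear_extension s ((- C) ^ n)) = (\<Sum>i\<in>I. ?c i ^ n)" for n
    by (simp add: linear_extension_of_int[OF s(2)] poly_of_int_power poly_of_int_uminus)
  then obtain R :: "int poly" where "map_poly of_int R = root_poly I ?c"
    using integral_root_poly[OF gauss_congruences_linear_extension_power[OF s, where C = "- C"], where I = I and a = ?c] by blast
  then have "poly (root_poly I ?c) 0 = of_int (coeff R 0)"
    by (metis coeff_map_poly of_int_0 poly_0_coeff_0)
  then show ?thesis
    by (simp add: poly_root_poly)
qed

text \<open>The inner product is the value of the second polynomial at \<open>a i\<close>. The first
  polynomial vanishes there, so only the multiple of \<open>n\<close> remains.\<close>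

lemma prod_root_differences_dvd:
  fixes Q R :: "int poly" and a :: "'i \<Rightarrow> complex" and b :: "'j \<Rightarrow> complex"
  assumes Q: "map_poly of_int Q = root_poly I a" and R: "map_poly of_int R = root_poly J b"
    and "finite I" and n: "\<And>i. int n dvd coeff Q i - coeff R i"
  shows "\<exists>u. (\<Prod>i\<in>I. \<Prod>j\<in>J. a i - b j) = of_int u \<and> int n ^ card I dvd u"
proof -
  have "[:int n:] dvd R - Q"
    using n by (simp add: const_poly_dvd_iff dvd_diff_commute)
  then obtain C where "R - Q = [:int n:] * C" by blast
  then have RQ: "R = Q + smult (int n) C"
    by (simp add: algebra_simps)
  have "(\<Prod>j\<in>J. a i - b j) = of_nat n * poly (map_poly of_int C) (a i)" if "i \<in> I" for i
  proof -
    have "poly (root_poly I a) (a i) = 0"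
      using that \<open>finite I\<close> by (auto simp: poly_root_poly)
    have "(\<Prod>j\<in>J. a i - b j) = poly (map_poly of_int R) (a i)"
      by (simp add: R poly_root_poly)
    also have "\<dots> = poly (root_poly I a) (a i) + of_nat n * poly (map_poly of_int C) (a i)"
      unfolding RQ by (simp add: Q poly_of_int_add poly_of_int_smult)
    finally show ?thesis
      using \<open>poly (root_poly I a) (a i) = 0\<close> by simp
  qed
  then have "(\<Prod>i\<in>I. \<Prod>j\<in>J. a i - b j) = of_nat n ^ card I * (\<Prod>i\<in>I. poly (map_poly of_int C) (a i))"
    by (simp add: prod.distrib)
  moreover obtain z where "(\<Prod>i\<in>I. poly (map_poly of_int C) (a i)) = of_int z"
    using prod_poly_roots_Ints[OF Q] by (metis Ints_cases)
  ultimately have "(\<Prod>i\<in>I. \<Prod>j\<in>J. a i - b j) = of_int (int n ^ card I * z)"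
    by simp
  then show ?thesis
    using dvd_triv_left by blast
qed

section \<open>Moebius divisors\<close>

lemma moebius_prime_mult:
  assumes p: "prime p" "\<not> p dvd q"
  shows "moebius (p * q) = - moebius q"
proof (cases "squarefree q")
  case True
  have "q > 0" using p by (auto intro!: Nat.gr0I)
  have "coprime p q"
    using p by (simp add: prime_imp_coprime)
  then have "squarefree (p * q)"
    using True p by (simp add: squarefree_mult_coprime squarefree_prime)
  moreover have "prime_factors (p * q) = insert p (prime_factors q)"
    using p \<open>q > 0\<close> by (simp add: prime_factors_product prime_factorization_prime prime_gt_0_nat)
  moreover have "p \<notin> prime_factors q"
    using p by auto
  ultimately show ?thesis
    using True by (simp add: moebius_def)
next
  case False
  then have "\<not> squarefree (p * q)"
    using squarefree_mono[of q "p * q"] by auto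
  then show ?thesis
    using False by (simp add: moebius_def)
qed

text \<open>The sign is a parameter so that one argument serves both \<open>D_plus\<close> and
  \<open>D_minus\<close>.\<close>

definition moebius_divisors :: "int \<Rightarrow> nat \<Rightarrow> nat set" where
  "moebius_divisors \<epsilon> n = {m. m dvd n \<and> moebius (n div m) = \<epsilon>}"

text \<open>Moves one factor \<open>p\<close> between \<open>m\<close> and its cofactor
  \<open>n div m\<close>.\<close>

definition toggle_prime :: "nat \<Rightarrow> nat \<Rightarrow> nat \<Rightarrow> nat" where
  "toggle_prime p n m = (if p dvd n div m then p * m else m div p)"

text \<open>The Moebius value is nonzero, so the cofactor is squarefree and contains
  \<open>p\<close> at most once. The last claim ensures that \<open>m\<close> or its partner has a
  cofactor prime to \<open>p\<close>.\<close>

lemma toggle_prime: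
  assumes p: "prime p" "p dvd n" and n: "n > 0"
    and m: "m \<in> moebius_divisors \<epsilon> n" and "\<epsilon> \<noteq> 0"
  shows "toggle_prime p n m \<in> moebius_divisors (- \<epsilon>) n"
    and "toggle_prime p n (toggle_prime p n m) = m"
    and "p dvd n div m \<Longrightarrow> \<not> p dvd n div toggle_prime p n m"
proof -
  define q where "q = n div m"
  have mq: "m dvd n" "n = m * q" "moebius q = \<epsilon>"
    using m by (auto simp: moebius_divisors_def q_def)
  have pos: "m > 0" "q > 0" "p > 0"
    using mq(2) n prime_gt_0_nat[OF p(1)] by (auto intro!: Nat.gr0I)
  have "toggle_prime p n m \<in> moebius_divisors (- \<epsilon>) n \<and> toggle_prime p n (toggle_prime p n m) = m
    \<and> (p dvd n div m \<longrightarrow> \<not> p dvd n div toggle_prime p n m)"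
  proof (cases "p dvd q")
    case True
    then obtain q' where q': "q = p * q'" by blast
    have "squarefree q"
      using mq(3) \<open>\<epsilon> \<noteq> 0\<close> by (auto simp: moebius_def split: if_splits)
    have "\<not> p dvd q'"
    proof
      assume "p dvd q'"
      then have "p ^ 2 dvd q"
        by (auto simp: q' power2_eq_square)
      then have "p dvd 1"
        using \<open>squarefree q\<close> by (rule squarefreeD[rotated])
      then show False
        using p(1) by (simp add: prime_nat_iff)
    qed
    moreover have "n = p * m * q'"
      by (simp add: mq(2) q')
    ultimately show ?thesis
      using True pos mq(3) moebius_prime_mult[OF p(1), of q']
      by (auto simp: toggle_prime_def moebius_divisors_def q' simp flip: q_def)
  next
    case False
    then have "p dvd m"
      using p mq(2) by (simp add: prime_dvd_mult_iff)
    then obtain m' where m': "m = p * m'" by blast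
    have n': "n = m' * (p * q)" "m' > 0"
      using mq(2) m' pos by auto
    then have "n div m' = p * q" by simp
    then show ?thesis
      using False pos mq(3) n' moebius_prime_mult[OF p(1) False]
      by (auto simp: toggle_prime_def moebius_divisors_def m' simp flip: q_def)
  qed
  then show "toggle_prime p n m \<in> moebius_divisors (- \<epsilon>) n"
    and "toggle_prime p n (toggle_prime p n m) = m"
    and "p dvd n div m \<Longrightarrow> \<not> p dvd n div toggle_prime p n m"
    by blast+
qed

lemma bij_betw_toggle_prime:
  assumes "prime p" "p dvd n" "n > 0"
  shows "bij_betw (toggle_prime p n) (moebius_divisors 1 n) (moebius_divisors (- 1) n)"
  using toggle_prime[OF assms, of _ 1] toggle_prime[OF assms, of _ "- 1"]
  by (intro bij_betwI[where g = "toggle_prime p n"]) auto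

lemma finite_moebius_divisors: "n > 0 \<Longrightarrow> finite (moebius_divisors \<epsilon> n)"
  by (simp add: moebius_divisors_def)

lemma moebius_divisors_pos: "n > 0 \<Longrightarrow> m \<in> moebius_divisors \<epsilon> n \<Longrightarrow> m > 0"
  by (auto simp: moebius_divisors_def dvd_pos_nat)

section \<open>Counting the divisors in each class\<close>

lemma prod_prime_factors_squarefree:
  fixes q :: nat
  assumes "squarefree q"
  shows "\<Prod>(prime_factors q) = q"
proof -
  have "q > 0" using assms by (auto intro!: Nat.gr0I)
  have "q = (\<Prod>p\<in>prime_factors q. p ^ multiplicity p q)"
    using \<open>q > 0\<close> by (rule prime_factorization_nat)
  also have "\<dots> = \<Prod>(prime_factors q)"
    using assms \<open>q > 0\<close> by (intro prod.cong) (auto simp: squarefree_factorial_semiring')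
  finally show ?thesis by simp
qed

text \<open>Squarefree divisors correspond to subsets of the prime factors.\<close>

lemma card_squarefree_divisors:
  fixes n :: nat
  assumes n: "n > 0"
  shows "card {q. q dvd n \<and> squarefree q} = 2 ^ card (prime_factors n)"
proof -
  have "bij_betw prime_factors {q. q dvd n \<and> squarefree q} (Pow (prime_factors n))"
  proof (rule bij_betwI[where g = "\<lambda>S. \<Prod>S"])
    show "prime_factors \<in> {q. q dvd n \<and> squarefree q} \<rightarrow> Pow (prime_factors n)"
      using n dvd_prime_factors[of n] by auto
    have S: "squarefree (\<Prod>S) \<and> \<Prod>S dvd n \<and> prime_factors (\<Prod>S) = S"
      if "S \<subseteq> prime_factors n" for S
    proof -
      have fin: "finite S"
        using that finite_subset by blast
      have pr: "prime p" if "p \<in> S" for p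
        using that \<open>S \<subseteq> prime_factors n\<close> by auto
      have "squarefree (\<Prod>S)"
        using pr by (intro squarefree_prod_coprime) (auto intro: primes_coprime squarefree_prime)
      moreover have "\<Prod>S dvd (\<Prod>p\<in>S. p ^ multiplicity p n)"
        using that n by (intro prod_dvd_prod dvd_power) (auto simp: prime_factors_multiplicity)
      then have "\<Prod>S dvd n"
        using prod_dvd_prod_subset[OF _ that, of "\<lambda>p. p ^ multiplicity p n"]
          prime_factorization_nat[OF n] dvd_trans by (metis finite_set_mset)
      moreover have "prime_factors (\<Prod>S) = S"
        using fin pr
      proof (induction S rule: finite_induct)
        case (insert p S)
        have "0 \<notin> S"
          using insert.prems not_prime_0 by blast
        then have "\<Prod>S \<noteq> 0"
          using insert.hyps by simp
        then show ?case
          using insert by (simp add: prime_factors_product prime_factorization_prime prime_gt_0_nat)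
      qed simp
      ultimately show ?thesis by blast
    qed
    then show "Prod \<in> Pow (prime_factors n) \<rightarrow> {q. q dvd n \<and> squarefree q}"
      "\<And>S. S \<in> Pow (prime_factors n) \<Longrightarrow> prime_factors (\<Prod>S) = S"
      by auto
  qed (simp add: prod_prime_factors_squarefree)
  then show ?thesis
    by (simp add: bij_betw_same_card card_Pow)
qed

text \<open>Passing to cofactors identifies the union of both classes with the squarefree divisors,
  and toggling a prime of \<open>n\<close> shows that the classes are equally large.\<close>

lemma card_moebius_divisors:
  assumes "n > 1"
  shows "card (moebius_divisors 1 n) = 2 ^ (card (prime_factors n) - 1)"
    and "card (moebius_divisors (- 1) n) = 2 ^ (card (prime_factors n) - 1)"
proof -
  obtain p where p: "prime p" "p dvd n"
    using assms prime_factor_nat by (metis less_irrefl)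
  have eq: "card (moebius_divisors 1 n) = card (moebius_divisors (- 1) n)"
    using bij_betw_toggle_prime[OF p] assms bij_betw_same_card by auto
  have "n div (n div m) = m" if "m dvd n" for m
    using that assms by (auto elim!: dvdE)
  then have bij: "bij_betw (\<lambda>m. n div m) (moebius_divisors 1 n \<union> moebius_divisors (- 1) n)
      {q. q dvd n \<and> squarefree q}"
    using assms
    by (intro bij_betwI[where g = "\<lambda>m. n div m"])
      (auto simp: moebius_divisors_def moebius_def minus_one_power_iff split: if_splits)
  then have "2 ^ card (prime_factors n) = card (moebius_divisors 1 n \<union> moebius_divisors (- 1) n)"
    using card_squarefree_divisors[of n] assms bij_betw_same_card[OF bij] by simp
  also have "\<dots> = card (moebius_divisors 1 n) + card (moebius_divisors (- 1) n)"
    using assms by (intro card_Un_disjoint finite_moebius_divisors) (auto simp: moebius_divisors_def)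
  finally have "2 ^ card (prime_factors n) = 2 * card (moebius_divisors 1 n)"
    using eq by simp
  moreover have "card (prime_factors n) > 0"
    using p assms by (auto simp: card_gt_0_iff prime_factors_dvd)
  ultimately show "card (moebius_divisors 1 n) = 2 ^ (card (prime_factors n) - 1)"
    by (cases "card (prime_factors n)") auto
  then show "card (moebius_divisors (- 1) n) = 2 ^ (card (prime_factors n) - 1)"
    using eq by simp
qed

section \<open>Matching the power sums of the two polynomials\<close>

lemma dvd_prod_diff:
  fixes f g :: "'i \<Rightarrow> int"
  assumes "\<And>i. i \<in> I \<Longrightarrow> N dvd f i - g i"
  shows "N dvd prod f I - prod g I"
  using cong_prod[of I f g N] assms by (simp add: cong_iff_dvd_diff)

text \<open>When \<open>s\<close> lists the power sums of the roots, these products are the power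
  sums of the polynomial with exponent set \<open>D\<close>.\<close>

lemma gauss_congruences_prod:
  assumes s: "gauss_congruences s" and D: "\<And>m. m \<in> D \<Longrightarrow> m > 0"
  shows "gauss_congruences (\<lambda>k. \<Prod>m\<in>D. s (m * k))"
  unfolding gauss_congruences_def
proof (intro allI impI dvd_prod_diff)
  fix p b k m :: nat
  assume "prime p" "k > 0" "m \<in> D"
  then show "int p ^ Suc b dvd s (m * (p ^ Suc b * k)) - s (m * (p ^ b * k))"
    using gauss_congruencesD[OF s, of p "m * k" b] D by (simp add: mult_ac)
qed

text \<open>If \<open>m\<close> has a cofactor prime to \<open>p\<close>, then \<open>m\<close>
  contains the whole power of \<open>p\<close> in \<open>n\<close>, and its partner is m / p. The
  Gauss congruence of \<open>s\<close> then compares the two matched factors.\<close>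

lemma moebius_divisors_prod_cong:
  assumes s: "gauss_congruences s" and p: "prime p" "p dvd n" and n: "n > 0" and k: "k > 0"
  shows "int p ^ (multiplicity p n + b) dvd
    (\<Prod>m\<in>moebius_divisors 1 n. s (m * (p ^ b * k))) -
    (\<Prod>m\<in>moebius_divisors (- 1) n. s (m * (p ^ b * k)))"
proof -
  define e where "e = multiplicity p n"
  then have "e > 0"
    using p n by (simp add: prime_multiplicity_gt_zero_iff)
  then obtain e' where e: "e = Suc e'"
    using gr0_implies_Suc by blast
  \<comment> \<open>The sign is left open because the member with cofactor prime to \<open>p\<close>
    may lie in either class.\<close>
  have step: "int p ^ (e + b) dvd s (m * (p ^ b * k)) - s (toggle_prime p n m * (p ^ b * k))"
    if "m \<in> moebius_divisors \<epsilon> n" "\<not> p dvd n div m" for m \<epsilon>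
  proof -
    have "p ^ e dvd m * (n div m)"
      using that(1) multiplicity_dvd[of p n] by (simp add: moebius_divisors_def e_def)
    moreover have "coprime (p ^ e) (n div m)"
      using that(2) p by (simp add: prime_imp_coprime)
    ultimately have "p ^ e dvd m"
      by (simp add: coprime_dvd_mult_left_iff)
    then obtain i where i: "m = p ^ e * i" by blast
    have "m > 0"
      using that(1) n moebius_divisors_pos by blast
    then have "i * k > 0"
      using i k by (auto intro!: Nat.gr0I)
    have "toggle_prime p n m = p ^ e' * i"
      using that(2) prime_gt_0_nat[OF p(1)] by (simp add: toggle_prime_def i e)
    then have "toggle_prime p n m * (p ^ b * k) = p ^ (e' + b) * (i * k)"
      by (simp only: power_add mult_ac)
    moreover have "m * (p ^ b * k) = p ^ Suc (e' + b) * (i * k)"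
      unfolding i e by (simp only: power_add power_Suc mult_ac)
    ultimately show ?thesis
      using gauss_congruencesD[OF s p(1) \<open>i * k > 0\<close>, of "e' + b"] by (simp only: e add_Suc)
  qed
  have "int p ^ (e + b) dvd s (m * (p ^ b * k)) - s (toggle_prime p n m * (p ^ b * k))"
    if m: "m \<in> moebius_divisors 1 n" for m
  proof (cases "p dvd n div m")
    case True
    \<comment> \<open>Now the partner has a cofactor prime to \<open>p\<close>; \<open>step\<close>
      applies to it, and toggling again returns \<open>m\<close>.\<close>
    have "int p ^ (e + b) dvd s (toggle_prime p n m * (p ^ b * k))
        - s (toggle_prime p n (toggle_prime p n m) * (p ^ b * k))"
      using toggle_prime[OF p n m] True by (intro step) auto
    then show ?thesis
      using toggle_prime(2)[OF p n m] by (simp add: dvd_diff_commute)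
  qed (use step m in blast)
  then have "int p ^ (e + b) dvd (\<Prod>m\<in>moebius_divisors 1 n. s (m * (p ^ b * k)))
      - (\<Prod>m\<in>moebius_divisors 1 n. s (toggle_prime p n m * (p ^ b * k)))"
    by (rule dvd_prod_diff)
  also have "(\<Prod>m\<in>moebius_divisors 1 n. s (toggle_prime p n m * (p ^ b * k))) =
      (\<Prod>m\<in>moebius_divisors (- 1) n. s (m * (p ^ b * k)))"
    by (rule prod.reindex_bij_betw[OF bij_betw_toggle_prime[OF p n]])
  finally show ?thesis
    by (simp only: e_def)
qed

text \<open>\<open>I\<close> consists of the tuples of root indices. Distributivity turns the power
  sum over tuples into a product of power sums of \<alpha>.\<close>

lemma root_product_poly_eq_root_poly:
  fixes \<alpha> :: "nat \<Rightarrow> complex" and d :: nat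
  assumes D: "finite D"
  obtains a :: "(nat \<Rightarrow> nat) \<Rightarrow> complex" and I where
    "root_product_poly \<alpha> d (mset_set D) = root_poly I a" "finite I" "card I = d ^ card D"
    "\<And>k. (\<Sum>i\<in>I. a i ^ k) = (\<Prod>m\<in>D. \<Sum>x\<in>{1..d}. \<alpha> x ^ (m * k))"
proof
  define ns where "ns = sorted_list_of_multiset (mset_set D)"
  define I where "I = {..<length ns} \<rightarrow>\<^sub>E {1..d}"
  define a where "a j = (\<Prod>i<length ns. \<alpha> (j i) ^ (ns ! i))" for j
  have ns: "set ns = D" "distinct ns" "length ns = card D"
    using D by (auto simp: ns_def)
  have mset_ns: "mset ns = mset_set D"
    unfolding ns_def by (rule mset_sorted_list_of_multiset)
  show "root_product_poly \<alpha> d (mset_set D) = root_poly I a"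
    unfolding mset_ns[symmetric] root_product_poly_mset
    by (simp add: root_product_poly_list_def root_poly_def I_def a_def)
  show "finite I"
    by (simp add: I_def finite_PiE)
  show "card I = d ^ card D"
    by (simp add: I_def card_PiE ns(3))
  show "(\<Sum>i\<in>I. a i ^ k) = (\<Prod>m\<in>D. \<Sum>x\<in>{1..d}. \<alpha> x ^ (m * k))" for k
  proof -
    have "(\<Sum>j\<in>I. a j ^ k) = (\<Sum>j\<in>I. \<Prod>i<length ns. \<alpha> (j i) ^ (ns ! i * k))"
      by (simp add: a_def prod_power_distrib power_mult)
    also have "\<dots> = (\<Prod>i<length ns. \<Sum>x\<in>{1..d}. \<alpha> x ^ (ns ! i * k))"
      unfolding I_def by (rule prod_sum_PiE[symmetric]) auto
    also have "\<dots> = (\<Prod>m\<in>D. \<Sum>x\<in>{1..d}. \<alpha> x ^ (m * k))"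
      by (rule prod.reindex_bij_betw) (use bij_betw_nth[OF ns(2)] ns(1) in auto)
    finally show ?thesis .
  qed
qed

theorem theorem4p1:
  fixes P :: "int poly" and \<alpha> :: "nat \<Rightarrow> complex" and d n l r :: nat
  assumes "lead_coeff P = 1"
    and "degree P = d"
    and "proots (map_poly complex_of_int P) = image_mset \<alpha> (mset_set {1..d})"
    and "n > 1"
    and "l = card (prime_factors n)"
    and "r = 2 ^ (l - 1)"
  shows "\<exists>u::int. U \<alpha> d n = of_int u \<and> int n ^ (d ^ r) dvd u"
proof -
  let ?D = "\<lambda>\<epsilon>. moebius_divisors \<epsilon> n"
  have n: "n > 0" using assms(4) by simp
  have "lead_coeff (map_poly complex_of_int P) = 1"
    using assms(1) by (simp add: coeff_map_poly degree_map_poly)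
  \<comment> \<open>Over the complex numbers a monic polynomial is the product of its linear
    factors.\<close>
  then have "map_poly complex_of_int P = root_poly {1..d} \<alpha>"
    using complex_poly_decompose_multiset[of "map_poly complex_of_int P"] assms(3)
    by (simp add: root_poly_def prod_unfold_prod_mset image_mset.compositionality o_def)
  then obtain s where s: "gauss_congruences s" "\<And>k. of_int (s k) = (\<Sum>x\<in>{1..d}. \<alpha> x ^ k)"
    using gauss_congruences_power_sums by blast
  obtain a :: "(nat \<Rightarrow> nat) \<Rightarrow> complex" and I where a: "root_product_poly \<alpha> d (mset_set (?D 1)) = root_poly I a"
    "finite I" "card I = d ^ card (?D 1)"
    "\<And>k. (\<Sum>i\<in>I. a i ^ k) = (\<Prod>m\<in>?D 1. \<Sum>x\<in>{1..d}. \<alpha> x ^ (m * k))"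
    using root_product_poly_eq_root_poly[OF finite_moebius_divisors[OF n], of \<alpha> d] by blast
  obtain b :: "(nat \<Rightarrow> nat) \<Rightarrow> complex" and J where b: "root_product_poly \<alpha> d (mset_set (?D (- 1))) = root_poly J b"
    "finite J" "card J = d ^ card (?D (- 1))"
    "\<And>k. (\<Sum>i\<in>J. b i ^ k) = (\<Prod>m\<in>?D (- 1). \<Sum>x\<in>{1..d}. \<alpha> x ^ (m * k))"
    using root_product_poly_eq_root_poly[OF finite_moebius_divisors[OF n], of \<alpha> d] by blast
  \<comment> \<open>Integer versions of the power sums of \<open>a\<close> and of \<open>b\<close>,
    for the signs 1 and -1.\<close>
  define t where "t \<epsilon> k = (\<Prod>m\<in>?D \<epsilon>. s (m * k))" for \<epsilon> k
  have t: "gauss_congruences (t \<epsilon>)" for \<epsilon>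
    unfolding t_def using s(1) moebius_divisors_pos[OF n] by (rule gauss_congruences_prod)
  have ta: "of_int (t 1 k) = (\<Sum>i\<in>I. a i ^ k)" and tb: "of_int (t (- 1) k) = (\<Sum>i\<in>J. b i ^ k)" for k
    by (simp_all add: t_def a(4) b(4) s(2))
  obtain Q :: "int poly" where Q: "map_poly of_int Q = root_poly I a"
    using integral_root_poly[OF t ta] by blast
  obtain R :: "int poly" where R: "map_poly of_int R = root_poly J b"
    using integral_root_poly[OF t tb] by blast
  have card: "card I = card J" "card I = d ^ r"
    using a(3) b(3) card_moebius_divisors[OF assms(4)] assms(5,6) by simp_all
  \<comment> \<open>Only prime powers need testing, and for each \<open>p\<close> the factors are
    matched by toggling that \<open>p\<close>.\<close>
  have "int n dvd coeff Q i - coeff R i" for i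
  proof (rule dvd_int_if_prime_powers_dvd[OF n])
    fix p assume p: "prime p" "p dvd n"
    have "int p ^ multiplicity p n dvd coeff Q i - coeff R i"
    proof (rule root_poly_coeff_cong[OF Q R card(1) t ta t tb p(1)])
      show "multiplicity p n \<ge> 1"
        using p n by (simp add: Suc_le_eq prime_multiplicity_gt_zero_iff)
    qed (use moebius_divisors_prod_cong[OF s(1) p n] in \<open>simp add: t_def\<close>)
    then show "int (p ^ multiplicity p n) dvd coeff Q i - coeff R i" by simp
  qed
  then have "\<exists>u. (\<Prod>i\<in>I. \<Prod>j\<in>J. a i - b j) = of_int u \<and> int n ^ card I dvd u"
    by (rule prod_root_differences_dvd[OF Q R a(2)])
  moreover have "U \<alpha> d n = (\<Prod>i\<in>I. \<Prod>j\<in>J. a i - b j)"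
    by (simp add: U_def Res_def D_plus_def D_minus_def a(1) b(1) proots_root_poly a(2) b(2)
        prod_unfold_prod_mset image_mset.compositionality o_def flip: moebius_divisors_def)
  ultimately show ?thesis
    by (simp add: card(2))
qed

end
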